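(* Let $1<\alpha<2$, $\gamma>0$, $\tau>0$, $\mathrm{a}<\mathrm{b}$, let $M\ge 8$ be even, $h=(\mathrm{b}-\mathrm{a})/(M+1)$, $\mu=\gamma\tau/h^\alpha$, let $D\in\mathbb{R}^{M\times M}$ be diagonal with nonpositive diagonal entries, and let $\omega>0$. Let $$\theta=\frac{\left(1-\frac{1+\alpha}{5+\alpha/2}\right)^{5+\alpha/2}e^{1+\alpha}\Gamma(\alpha+1)\sin(\pi\alpha/2)}{\pi\alpha},\qquad \theta_0=\frac{\sqrt2\,e^{13/12}\Gamma(1+\alpha)\sin(\pi\alpha/2)}{\pi\alpha}.$$ Let $\epsilon$ satisfy $2^\alpha\mu\theta_0/(M-2)^\alpha<\epsilon\le\mu\theta_0$ and set $k_0=\lceil(\mu\theta_0/\epsilon)^{1/\alpha}\rceil+1$. Then there exist matrices $\mathcal{E}_{\omega c},\mathcal{F}_{\omega c}\in\mathbb{R}^{2M\times 2M}$ with $\mathrm{rank}(\mathcal{E}_{\omega c})=4k_0$, $$\|\mathcal{E}_{\omega c}\|_2\le\frac{M^{1/2}\mu}{\sqrt{1+\left[\omega+\frac{2^{\alpha+1}\gamma\tau\theta}{(\mathrm{b}-\mathrm{a})^\alpha}\right]^2}}\left[\frac{c_0}{2}-\frac{\theta}{(M-1/2)^\alpha}\right],\qquad \|\mathcal{F}_{\omega c}\|_2\le\frac{M^{1/2}\epsilon}{\sqrt{1+\left[\omega+\frac{2^{\alpha+1}\gamma\tau\theta}{(\mathrm{b}-\mathrm{a})^\alpha}\right]^2}},$$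 such that $\widetilde{\mathcal{F}}_\omega^{-1}\mathcal{F}_\omega=I+\mathcal{E}_{\omega c}+\mathcal{F}_{\omega c}$.
   Context: For $k\in\mathbb{Z}$, $c_k=(-1)^k\Gamma(\alpha+1)/[\Gamma(\alpha/2-k+1)\Gamma(\alpha/2+k+1)]$ ($\Gamma$ the gamma function, $1/\Gamma=0$ at poles); in particular $c_0=\Gamma(\alpha+1)/\Gamma(\alpha/2+1)^2$. $T\in\mathbb{R}^{M\times M}$ is the symmetric Toeplitz matrix with entries $T_{jk}=\mu c_{j-k}$. For even $M$, $C\in\mathbb{R}^{M\times M}$ is Strang's circulant approximation of $T$: the symmetric circulant matrix whose first row is $\mu(c_0,c_1,\dots,c_{M/2-1},0,c_{M/2-1},\dots,c_1)$, each subsequent row being the cyclic right shift of the previous one. With $I$ the identity of the appropriate size, define $$\mathcal{B}=\begin{bmatrix}-D&0\\0&-D\end{bmatrix},\quad \mathcal{H}=\begin{bmatrix}T&-I\\ I&T\end{bmatrix},\quad \mathcal{C}=\begin{bmatrix}C&-I\\ I&C\end{bmatrix},$$ $$\mathcal{F}_\omega=\tfrac{1}{2\omega}(\omega I+\mathcal{B})(\omega I+\mathcal{H}),\qquad \widetilde{\mathcal{F}}_\omega=\tfrac{1}{2\omega}(\omega I+\mathcal{B})(\omega I+\mathcal{C}).$$ $\|\cdot\|_2$ is the spectral norm. *)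

theory Defs
  imports "HOL-Analysis.Analysis"
begin

text \<open>Coefficients c_k; rGamma is the reciprocal Gamma function (zero at the poles).\<close>
definition frac_coef :: "real \<Rightarrow> int \<Rightarrow> real" where
  "frac_coef \<alpha> k = (-1) powi k * Gamma (\<alpha> + 1) * rGamma (\<alpha>/2 - of_int k + 1) * rGamma (\<alpha>/2 + of_int k + 1)"

definition idx :: "'n::{finite,linorder} \<Rightarrow> nat" where
  "idx i = card {j. j < i}"

definition toeplitz_T :: "real \<Rightarrow> real \<Rightarrow> real^('n::{finite,linorder})^('n::{finite,linorder})" where
  "toeplitz_T \<alpha> \<mu> = (\<chi> j k. \<mu> * frac_coef \<alpha> (int (idx j) - int (idx k)))"

text \<open>Entry r (0 \<le> r < M) of the first row of Strang's circulant (without the factor mu).\<close>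
definition strang_row :: "real \<Rightarrow> nat \<Rightarrow> int \<Rightarrow> real" where
  "strang_row \<alpha> M r = (if r < int M div 2 then frac_coef \<alpha> r
                        else if r = int M div 2 then 0 else frac_coef \<alpha> (int M - r))"

definition strang_C :: "real \<Rightarrow> real \<Rightarrow> real^('n::{finite,linorder})^('n::{finite,linorder})" where
  "strang_C \<alpha> \<mu> = (\<chi> j k. \<mu> * strang_row \<alpha> CARD('n) ((int (idx k) - int (idx j)) mod int CARD('n)))"

definition block2 :: "real^'n^'n \<Rightarrow> real^'n^'n \<Rightarrow> real^'n^'n \<Rightarrow> real^'n^'n \<Rightarrow> real^('n+'n)^('n+'n)" where
  "block2 P Q R S = (\<chi> i j. case i of
       Inl a \<Rightarrow> (case j of Inl b \<Rightarrow> P$a$b | Inr b \<Rightarrow> Q$a$b)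
     | Inr a \<Rightarrow> (case j of Inl b \<Rightarrow> R$a$b | Inr b \<Rightarrow> S$a$b))"

definition spec_norm :: "real^'m::finite^'n::finite \<Rightarrow> real" where
  "spec_norm A = onorm (\<lambda>x. A *v x)"

end

theory Submission
  imports Defs
begin

text \<open>
  The coefficients c_k with k \<ge> 1 are negative and increasing, and the tails
  s(m) of the sum of |c_k| have a closed form as a ratio of Gamma values; log-convexity of Gamma
  traps s(m) between A / (m + 1/2)^\<alpha> and A / (m - 1)^\<alpha>, where A is the common factor of
  \<theta> and \<theta>_0, and c_0 = 2 s(1).

  The factor \<omega> I + B cancels, so the preconditioned matrix is the identity plus
  (\<omega> I + C)^{-1} applied to two diagonal copies of W = T - C. The matrix W vanishes at distance
  less than M/2 from the diagonal, and at distance r \<ge> M/2 its entry is at most \<mu> |c_{M-r}| in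
  absolute value. The part of W at distance at least M - k_0 consists of two triangular k_0 by k_0
  corners with nonzero diagonal, so it has rank 2 k_0 and row sums at most \<mu> (s(1) - s(k_0 + 1));
  the rest has row sums at most \<mu> s(k_0 + 1). For symmetric matrices row sums bound the spectral
  norm. Finally the circulant block is coercive with constant 2 \<mu> s(M/2), and the skew coupling
  by I and -I adds 1 to the square of the smallest singular value.
\<close>

definition tail_const :: "real \<Rightarrow> real" where
  "tail_const \<alpha> = Gamma (\<alpha> + 1) * sin (pi * \<alpha> / 2) / (pi * \<alpha>)"

text \<open>At a positive integer x this is the tail sum of |c_k| over k \<ge> x: the summands telescope
  because Gamma (k - \<alpha>/2) / Gamma (k + \<alpha>/2) decreases by
  \<alpha> Gamma (k - \<alpha>/2) / Gamma (k + \<alpha>/2 + 1) from k to k + 1.\<close>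
definition frac_tail :: "real \<Rightarrow> real \<Rightarrow> real" where
  "frac_tail \<alpha> x = tail_const \<alpha> * (Gamma (x - \<alpha>/2) / Gamma (x + \<alpha>/2))"

lemma rGamma_reflection_real:
  fixes x :: real
  shows "rGamma x * rGamma (1 - x) = sin (pi * x) / pi"
proof -
  have "complex_of_real (rGamma x * rGamma (1 - x)) = complex_of_real (sin (pi * x) / pi)"
    using rGamma_reflection_complex[of "of_real x"]
    by (simp add: rGamma_complex_of_real [symmetric] sin_of_real [symmetric])
  then show ?thesis by (simp only: of_real_eq_iff)
qed

lemma Gamma_plus1_real_pos: "0 < x \<Longrightarrow> Gamma (x + 1) = x * Gamma (x :: real)"
  by (rule Gamma_plus1) (auto elim!: nonpos_Ints_cases)

lemma Gamma_ratio_upper: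
  fixes x s :: real
  assumes "0 < x" "0 \<le> s" "s \<le> 1"
  shows "Gamma (x + 1 + s) \<le> x * (x + 1) powr s * Gamma x"
proof -
  have "(ln \<circ> Gamma) ((1 - s) *\<^sub>R (x + 1) + s *\<^sub>R (x + 2))
      \<le> (1 - s) * (ln \<circ> Gamma) (x + 1) + s * (ln \<circ> Gamma) (x + 2)"
    by (rule convex_onD[OF log_convex_Gamma_real]) (use assms in auto)
  moreover have "(1 - s) *\<^sub>R (x + 1) + s *\<^sub>R (x + 2) = x + 1 + s"
    by (simp add: algebra_simps)
  moreover have G1: "Gamma (x + 1) = x * Gamma x"
    using assms by (simp add: Gamma_plus1_real_pos)
  moreover have "Gamma (x + 2) = (x + 1) * Gamma (x + 1)"
    using Gamma_plus1_real_pos[of "x + 1"] assms by (simp add: add.assoc)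
  moreover have "ln ((x + 1) * Gamma (x + 1)) = ln (x + 1) + ln (Gamma (x + 1))"
    using assms Gamma_real_pos[of "x + 1"] by (intro ln_mult_pos) auto
  ultimately have "ln (Gamma (x + 1 + s)) \<le> ln (Gamma (x + 1)) + s * ln (x + 1)"
    by (simp add: algebra_simps)
  then have "Gamma (x + 1 + s) \<le> exp (ln (Gamma (x + 1)) + s * ln (x + 1))"
    using assms by (metis Gamma_real_pos add_pos_nonneg add_pos_pos exp_le_cancel_iff exp_ln zero_less_one)
  also have "\<dots> = x * (x + 1) powr s * Gamma x"
    using assms Gamma_real_pos[of "x + 1"] by (simp add: exp_add powr_def G1)
  finally show ?thesis .
qed

lemma Gamma_ratio_lower:
  fixes x a :: real
  assumes "0 < x" "1 \<le> a"
  shows "x powr a * Gamma x \<le> Gamma (x + a)"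
proof -
  have "(ln \<circ> Gamma) ((1 - 1/a) *\<^sub>R x + (1/a) *\<^sub>R (x + a))
      \<le> (1 - 1/a) * (ln \<circ> Gamma) x + (1/a) * (ln \<circ> Gamma) (x + a)"
    by (rule convex_onD[OF log_convex_Gamma_real]) (use assms in auto)
  moreover have "(1 - 1/a) *\<^sub>R x + (1/a) *\<^sub>R (x + a) = x + 1"
    using assms by (simp add: field_simps)
  moreover have G1: "Gamma (x + 1) = x * Gamma x"
    using assms by (simp add: Gamma_plus1_real_pos)
  moreover have "ln (x * Gamma x) = ln x + ln (Gamma x)"
    using assms by (intro ln_mult_pos) auto
  ultimately have "a * (ln x + ln (Gamma x)) \<le> a * ((1 - 1/a) * ln (Gamma x) + (1/a) * ln (Gamma (x + a)))"
    using assms by (intro mult_left_mono) (auto simp only: o_def)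
  then have "a * ln x + ln (Gamma x) \<le> ln (Gamma (x + a))"
    using assms by (simp add: algebra_simps)
  then have "exp (a * ln x + ln (Gamma x)) \<le> Gamma (x + a)"
    using assms by (subst (asm) ln_ge_iff) auto
  then show ?thesis
    using assms by (simp add: exp_add powr_def)
qed

lemma powr_one_minus_div_le:
  fixes u n :: real
  assumes "0 < n" "u \<le> n"
  shows "(1 - u / n) powr n * exp u \<le> 1"
proof -
  have "(1 - u / n) powr n \<le> exp (- u / n) powr n"
    using assms exp_ge_add_one_self[of "- u / n"] by (intro powr_mono2) auto
  also have "\<dots> = exp (- u)"
    using assms by (simp add: powr_def)
  finally have "(1 - u / n) powr n * exp u \<le> exp (- u) * exp u"
    by (rule mult_right_mono) simp
  then show ?thesis
    by (simp flip: exp_add)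
qed

lemma frac_coef_minus: "frac_coef \<alpha> (- k) = frac_coef \<alpha> k"
  by (simp add: frac_coef_def power_int_minus_left add_ac mult_ac)

context
  fixes \<alpha> :: real
  assumes \<alpha>: "1 < \<alpha>" "\<alpha> < 2"
begin

lemma tail_const_pos: "0 < tail_const \<alpha>"
proof -
  have "0 < sin (pi * \<alpha> / 2)"
    using \<alpha> by (intro sin_gt_zero) (auto simp: field_simps)
  then show ?thesis
    using \<alpha> by (auto simp: tail_const_def)
qed

lemma frac_tail_pos: "1 \<le> x \<Longrightarrow> 0 < frac_tail \<alpha> x"
  using \<alpha> tail_const_pos by (auto simp: frac_tail_def intro!: mult_pos_pos divide_pos_pos)

lemma frac_tail_lower:
  assumes "1 \<le> x"
  shows "tail_const \<alpha> / (x + 1/2) powr \<alpha> \<le> frac_tail \<alpha> x"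
proof -
  define y where "y = x - \<alpha>/2"
  have y: "0 < y" using \<alpha> assms by (simp add: y_def)
  have "Gamma (x + \<alpha>/2) \<le> y * (y + 1) powr (\<alpha> - 1) * Gamma y"
    using Gamma_ratio_upper[of y "\<alpha> - 1"] y \<alpha> by (simp add: y_def add.commute)
  also have "y * (y + 1) powr (\<alpha> - 1) \<le> (x + 1/2) * (x + 1/2) powr (\<alpha> - 1)"
    using y \<alpha> by (intro mult_mono powr_mono2) (auto simp: y_def)
  also have "\<dots> = (x + 1/2) powr \<alpha>"
    using assms by (simp add: powr_diff)
  finally have "Gamma (x + \<alpha>/2) \<le> (x + 1/2) powr \<alpha> * Gamma y"
    using y by (simp add: mult_right_mono)
  then have "1 / (x + 1/2) powr \<alpha> \<le> Gamma y / Gamma (x + \<alpha>/2)"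
    using assms \<alpha> by (simp add: field_simps)
  from mult_left_mono[OF this, of "tail_const \<alpha>"] show ?thesis
    using tail_const_pos by (simp add: frac_tail_def y_def)
qed

lemma frac_tail_upper:
  assumes "1 < x"
  shows "frac_tail \<alpha> x \<le> tail_const \<alpha> / (x - 1) powr \<alpha>"
proof -
  define y where "y = x - \<alpha>/2"
  have y: "0 < y" using \<alpha> assms by (simp add: y_def)
  have "(x - 1) powr \<alpha> * Gamma y \<le> y powr \<alpha> * Gamma y"
    using y \<alpha> assms by (intro mult_right_mono powr_mono2) (auto simp: y_def)
  also have "\<dots> \<le> Gamma (x + \<alpha>/2)"
    using Gamma_ratio_lower[of y \<alpha>] y \<alpha> by (simp add: y_def add.commute)
  finally have "Gamma y / Gamma (x + \<alpha>/2) \<le> 1 / (x - 1) powr \<alpha>"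
    using assms \<alpha> by (simp add: field_simps)
  from mult_left_mono[OF this, of "tail_const \<alpha>"] show ?thesis
    using tail_const_pos by (simp add: frac_tail_def y_def)
qed

lemma frac_coef_closed_form:
  assumes "1 \<le> k"
  shows "frac_coef \<alpha> (int k) =
    - (\<alpha> * tail_const \<alpha> * (Gamma (real k - \<alpha>/2) / Gamma (real k + \<alpha>/2 + 1)))"
proof -
  define z where "z = real k - \<alpha>/2"
  have z: "0 < z" using \<alpha> assms by (simp add: z_def)
  have "sin (pi * z) = - ((-1) ^ k * sin (pi * \<alpha> / 2))"
    by (simp add: z_def right_diff_distrib sin_diff mult.commute)
  then have "rGamma (1 - z) = - ((-1) ^ k * sin (pi * \<alpha> / 2)) / pi * Gamma z"
    using rGamma_reflection_real[of z] Gamma_real_pos[OF z]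
    by (simp add: rGamma_inverse_Gamma[of z] field_simps)
  then have rG: "rGamma (\<alpha>/2 - real k + 1) = - ((-1) ^ k * sin (pi * \<alpha> / 2)) / pi * Gamma z"
    by (simp add: z_def algebra_simps)
  have "frac_coef \<alpha> (int k) = ((-1) ^ k * (-1) ^ k) *
      - (Gamma (\<alpha> + 1) * sin (pi * \<alpha> / 2) / pi * (Gamma z * rGamma (\<alpha>/2 + real k + 1)))"
    unfolding frac_coef_def of_int_of_nat_eq rG by (simp add: mult_ac)
  also have "(-1) ^ k * (-1) ^ k = (1 :: real)"
    by (simp flip: power_mult_distrib)
  also have "Gamma (\<alpha> + 1) * sin (pi * \<alpha> / 2) / pi = \<alpha> * tail_const \<alpha>"
    using \<alpha> by (simp add: tail_const_def)
  finally show ?thesis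
    by (simp only: z_def rGamma_inverse_Gamma divide_inverse add.commute mult_1_left)
qed

lemma frac_coef_neg: "1 \<le> k \<Longrightarrow> frac_coef \<alpha> (int k) < 0"
  using \<alpha> tail_const_pos
  by (subst frac_coef_closed_form) (auto intro!: mult_pos_pos divide_pos_pos)

lemma frac_coef_eq_tail_diff:
  assumes "1 \<le> k"
  shows "frac_coef \<alpha> (int k) = frac_tail \<alpha> (real k + 1) - frac_tail \<alpha> (real k)"
proof -
  have 1: "Gamma (real k - \<alpha>/2 + 1) = (real k - \<alpha>/2) * Gamma (real k - \<alpha>/2)"
    using assms \<alpha> by (intro Gamma_plus1_real_pos) auto
  have 2: "Gamma (real k + \<alpha>/2 + 1) = (real k + \<alpha>/2) * Gamma (real k + \<alpha>/2)"
    using assms \<alpha> by (intro Gamma_plus1_real_pos) auto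
  have e: "real k + 1 - \<alpha>/2 = real k - \<alpha>/2 + 1" "real k + 1 + \<alpha>/2 = real k + \<alpha>/2 + 1"
    by simp_all
  have g: "Gamma (real k + \<alpha>/2) > 0" "real k + \<alpha>/2 > 0"
    using \<alpha> by auto
  show ?thesis
    unfolding frac_coef_closed_form[OF assms] frac_tail_def e 1 2
    using g by (simp add: divide_simps) (simp add: algebra_simps)
qed

lemma frac_coef_0: "frac_coef \<alpha> 0 = 2 * frac_tail \<alpha> 1"
proof -
  have g: "Gamma (\<alpha>/2 + 1) = \<alpha>/2 * Gamma (\<alpha>/2)"
    using \<alpha> by (intro Gamma_plus1_real_pos) auto
  have "rGamma (\<alpha>/2) * rGamma (1 - \<alpha>/2) = sin (pi * \<alpha> / 2) / pi"
    using rGamma_reflection_real[of "\<alpha>/2"] by simp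
  moreover have pos: "Gamma (\<alpha>/2) > 0" "Gamma (1 - \<alpha>/2) > 0"
    using \<alpha> by auto
  ultimately have sin: "sin (pi * \<alpha> / 2) = pi / (Gamma (\<alpha>/2) * Gamma (1 - \<alpha>/2))"
    by (simp add: rGamma_inverse_Gamma field_simps)
  have "2 * frac_tail \<alpha> 1 = Gamma (\<alpha> + 1) * 2 / (\<alpha> * Gamma (\<alpha>/2) * Gamma (\<alpha>/2 + 1))"
    using pos(2) by (simp add: frac_tail_def tail_const_def sin add.commute[of 1] mult_ac)
  also have "\<dots> = Gamma (\<alpha> + 1) / (Gamma (\<alpha>/2 + 1) * Gamma (\<alpha>/2 + 1))"
    unfolding g by simp
  finally show ?thesis
    by (simp add: frac_coef_def rGamma_inverse_Gamma inverse_eq_divide)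
qed

lemma frac_coef_less_Suc:
  assumes "1 \<le> k"
  shows "frac_coef \<alpha> (int k) < frac_coef \<alpha> (int (Suc k))"
proof -
  have 1: "Gamma (real k - \<alpha>/2 + 1) = (real k - \<alpha>/2) * Gamma (real k - \<alpha>/2)"
    using assms \<alpha> by (intro Gamma_plus1_real_pos) auto
  have 2: "Gamma (real k + \<alpha>/2 + 1 + 1) = (real k + \<alpha>/2 + 1) * Gamma (real k + \<alpha>/2 + 1)"
    using assms \<alpha> by (intro Gamma_plus1_real_pos) auto
  have e: "real (Suc k) - \<alpha>/2 = real k - \<alpha>/2 + 1" "real (Suc k) + \<alpha>/2 + 1 = real k + \<alpha>/2 + 1 + 1"
    by simp_all
  have "frac_coef \<alpha> (int (Suc k)) = (real k - \<alpha>/2) / (real k + \<alpha>/2 + 1) * frac_coef \<alpha> (int k)"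
    unfolding frac_coef_closed_form[OF assms] frac_coef_closed_form[OF le_SucI[OF assms]] e 1 2
    by simp
  moreover have "(real k - \<alpha>/2) / (real k + \<alpha>/2 + 1) < 1"
    using \<alpha> by (simp add: field_simps)
  ultimately show ?thesis
    using frac_coef_neg[OF assms] mult_strict_right_mono_neg by fastforce
qed

lemma frac_coef_strict_mono:
  assumes "1 \<le> j" "j < k"
  shows "frac_coef \<alpha> (int j) < frac_coef \<alpha> (int k)"
  using assms(2,1)
proof (induction rule: less_Suc_induct)
  case (1 i) then show ?case by (rule frac_coef_less_Suc)
next
  case (2 i j k) then show ?case by fastforce
qed

lemma sum_abs_frac_coef:
  assumes "1 \<le> p" "p \<le> q"
  shows "(\<Sum>k=p..<q. \<bar>frac_coef \<alpha> (int k)\<bar>) = frac_tail \<alpha> (real p) - frac_tail \<alpha> (real q)"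
  using assms(2)
proof (induction rule: dec_induct)
  case base then show ?case by simp
next
  case (step n) then show ?case
    using assms(1) frac_coef_eq_tail_diff[of n] frac_coef_neg[of n] by (simp add: add.commute)
qed

lemma frac_tail_Suc_le_1: "frac_tail \<alpha> (real k + 1) \<le> frac_tail \<alpha> 1"
  using sum_abs_frac_coef[of 1 "k + 1"] sum_nonneg[of "{1..<k + 1}" "\<lambda>p. \<bar>frac_coef \<alpha> (int p)\<bar>"]
  by (simp add: add.commute)

end

lemma norm_matrix_vector_mult_le_row_col_sums:
  fixes A :: "real^'m^'n"
  assumes row: "\<And>i. (\<Sum>j\<in>UNIV. \<bar>A$i$j\<bar>) \<le> R" and col: "\<And>j. (\<Sum>i\<in>UNIV. \<bar>A$i$j\<bar>) \<le> R"
  shows "norm (A *v x) \<le> R * norm x"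
proof -
  have R: "0 \<le> R"
    using row[of undefined] sum_nonneg[of UNIV "\<lambda>j. \<bar>A$undefined$j\<bar>"] by linarith
  have entry: "((A *v x)$i)\<^sup>2 \<le> R * (\<Sum>j\<in>UNIV. \<bar>A$i$j\<bar> * (x$j)\<^sup>2)" for i
  proof -
    have "\<bar>(A *v x)$i\<bar> \<le> (\<Sum>j\<in>UNIV. \<bar>A$i$j * x$j\<bar>)"
      unfolding matrix_vector_mult_def by (simp add: sum_abs)
    also have "\<dots> = (\<Sum>j\<in>UNIV. sqrt \<bar>A$i$j\<bar> * (sqrt \<bar>A$i$j\<bar> * \<bar>x$j\<bar>))"
      by (simp add: abs_mult flip: mult.assoc)
    finally have "((A *v x)$i)\<^sup>2 \<le> (\<Sum>j\<in>UNIV. sqrt \<bar>A$i$j\<bar> * (sqrt \<bar>A$i$j\<bar> * \<bar>x$j\<bar>))\<^sup>2"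
      by (rule abs_le_square_iff[THEN iffD1, OF order_trans[OF _ abs_ge_self]])
    also have "\<dots> \<le> (\<Sum>j\<in>UNIV. (sqrt \<bar>A$i$j\<bar>)\<^sup>2) * (\<Sum>j\<in>UNIV. (sqrt \<bar>A$i$j\<bar> * \<bar>x$j\<bar>)\<^sup>2)"
      by (rule Cauchy_Schwarz_ineq_sum)
    also have "\<dots> = (\<Sum>j\<in>UNIV. \<bar>A$i$j\<bar>) * (\<Sum>j\<in>UNIV. \<bar>A$i$j\<bar> * (x$j)\<^sup>2)"
      by (simp add: power_mult_distrib)
    also have "\<dots> \<le> R * (\<Sum>j\<in>UNIV. \<bar>A$i$j\<bar> * (x$j)\<^sup>2)"
      by (intro mult_right_mono row sum_nonneg) auto
    finally show ?thesis .
  qed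
  have "(norm (A *v x))\<^sup>2 = (\<Sum>i\<in>UNIV. ((A *v x)$i)\<^sup>2)"
    unfolding power2_norm_eq_inner inner_vec_def by (simp add: power2_eq_square)
  also have "\<dots> \<le> (\<Sum>i\<in>UNIV. R * (\<Sum>j\<in>UNIV. \<bar>A$i$j\<bar> * (x$j)\<^sup>2))"
    by (intro sum_mono entry)
  also have "\<dots> = R * (\<Sum>j\<in>UNIV. (\<Sum>i\<in>UNIV. \<bar>A$i$j\<bar>) * (x$j)\<^sup>2)"
    unfolding sum_distrib_left[symmetric] sum_distrib_right by (subst sum.swap) simp
  also have "\<dots> \<le> R * (\<Sum>j\<in>UNIV. R * (x$j)\<^sup>2)"
    by (intro mult_left_mono sum_mono mult_right_mono col R) auto
  also have "\<dots> = (R * norm x)\<^sup>2"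
    unfolding power_mult_distrib power2_norm_eq_inner inner_vec_def
    by (simp add: power2_eq_square sum_distrib_left mult.assoc)
  finally show ?thesis
    by (rule power2_le_imp_le) (use R in auto)
qed

lemma rank_mult_eq_card_support:
  fixes A N :: "real^'n^'n"
  assumes N: "\<And>x. N *v x = 0 \<Longrightarrow> x = 0"
    and rows: "\<And>i j. i \<notin> S \<Longrightarrow> A$i$j = 0"
    and ker: "\<And>x. (\<And>j. j \<notin> S \<Longrightarrow> x$j = 0) \<Longrightarrow> A *v x = 0 \<Longrightarrow> x = 0"
  shows "rank (N ** A) = card S"
proof (rule antisym)
  let ?V = "{x::real^'n. \<forall>i. i \<notin> S \<longrightarrow> x$i = 0}"
  have V: "dim ?V = card S"
    using dim_substandard_cart[of S, where 'a = real] by (simp add: dim_vec_eq)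
  have "rank A \<le> dim ?V"
    unfolding rank_dim_range
    by (rule dim_subset) (auto simp: matrix_vector_mult_def rows)
  then show "rank (N ** A) \<le> card S"
    using rank_mul_le_right[of N A] V by linarith
  have sub: "subspace ?V"
    by (auto simp: subspace_def)
  have inj: "inj_on ((*v) (N ** A)) ?V"
  proof (rule inj_onI)
    fix x y assume xy: "x \<in> ?V" "y \<in> ?V" "(N ** A) *v x = (N ** A) *v y"
    then have "(N ** A) *v (x - y) = 0"
      by (simp only: matrix_vector_mult_diff_distrib diff_self)
    then have "N *v (A *v (x - y)) = 0"
      by (simp only: matrix_vector_mul_assoc)
    then have "A *v (x - y) = 0" by (rule N)
    moreover have "(x - y)$j = 0" if "j \<notin> S" for j
      using xy(1,2) that by simp
    ultimately have "x - y = 0" using ker by blast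
    then show "x = y" by simp
  qed
  have "span ?V = ?V"
    using sub by (simp only: span_eq_iff)
  with inj have "inj_on ((*v) (N ** A)) (span ?V)"
    by (simp only:)
  then have "dim ((*v) (N ** A) ` ?V) = dim ?V"
    by (rule dim_image_eq[OF matrix_vector_mul_linear])
  moreover have "dim ((*v) (N ** A) ` ?V) \<le> rank (N ** A)"
    unfolding rank_dim_range by (rule dim_subset) auto
  ultimately show "card S \<le> rank (N ** A)"
    using V by linarith
qed

lemma sum_UNIV_sum_type:
  fixes f :: "'a::finite + 'b::finite \<Rightarrow> 'c::comm_monoid_add"
  shows "(\<Sum>i\<in>UNIV. f i) = (\<Sum>i\<in>UNIV. f (Inl i)) + (\<Sum>i\<in>UNIV. f (Inr i))"
  by (simp flip: UNIV_Plus_UNIV add: sum.Plus)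

definition upper_half :: "real^('n::finite+'n) \<Rightarrow> real^'n" where
  "upper_half z = (\<chi> i. z $ Inl i)"

definition lower_half :: "real^('n::finite+'n) \<Rightarrow> real^'n" where
  "lower_half z = (\<chi> i. z $ Inr i)"

lemma norm_halves: "(norm z)\<^sup>2 = (norm (upper_half z))\<^sup>2 + (norm (lower_half z))\<^sup>2"
  by (simp add: power2_norm_eq_inner inner_vec_def sum_UNIV_sum_type upper_half_def lower_half_def)

lemma halves_block2:
  "upper_half (block2 P Q R S *v z) = P *v upper_half z + Q *v lower_half z"
  "lower_half (block2 P Q R S *v z) = R *v upper_half z + S *v lower_half z"
  by (simp_all add: vec_eq_iff matrix_vector_mult_def block2_def sum_UNIV_sum_type
      upper_half_def lower_half_def)

lemma halves_zero: "upper_half z = 0 \<Longrightarrow> lower_half z = 0 \<Longrightarrow> z = 0"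
  using norm_halves[of z] by simp

lemma add_block2: "block2 P Q R S + block2 P' Q' R' S' = block2 (P + P') (Q + Q') (R + R') (S + S')"
  by (auto simp: vec_eq_iff block2_def split: sum.split)

lemma scaleR_mat_1_block2: "c *\<^sub>R mat 1 = block2 (c *\<^sub>R mat 1) 0 0 (c *\<^sub>R mat 1)"
  by (auto simp: vec_eq_iff block2_def mat_def split: sum.split)

lemma norm_skew_block2_ge:
  fixes S :: "real^'n^'n"
  assumes sym: "transpose S = S"
    and coercive: "\<And>x. s * (norm x)\<^sup>2 \<le> x \<bullet> (S *v x)" and s: "0 \<le> s"
  shows "sqrt (1 + s\<^sup>2) * norm z \<le> norm (block2 S (- mat 1) (mat 1) S *v z)"
proof -
  have ge: "(s * norm x)\<^sup>2 \<le> (norm (S *v x))\<^sup>2" for x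
  proof -
    have "norm x * (s * norm x) \<le> norm x * norm (S *v x)"
      using coercive[of x] norm_cauchy_schwarz[of x "S *v x"]
      by (simp add: power2_eq_square mult_ac)
    then have "s * norm x \<le> norm (S *v x)"
      by (cases "x = 0") auto
    then show ?thesis
      using s by (intro power_mono) auto
  qed
  define x y where "x = upper_half z" and "y = lower_half z"
  have "(S *v x) \<bullet> y = x \<bullet> (S *v y)"
    by (metis sym dot_lmul_matrix vector_transpose_matrix transpose_matrix_vector)
  then have "(norm (S *v x - y))\<^sup>2 + (norm (x + S *v y))\<^sup>2
      = (norm (S *v x))\<^sup>2 + (norm (S *v y))\<^sup>2 + (norm x)\<^sup>2 + (norm y)\<^sup>2"
    by (simp add: power2_norm_eq_inner inner_simps inner_commute)
  moreover have "- mat 1 *v y = - y"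
    using matrix_vector_mult_diff_rdistrib[of 0 "mat 1" y] by simp
  ultimately have "(norm (block2 S (- mat 1) (mat 1) S *v z))\<^sup>2
      = (norm (S *v x))\<^sup>2 + (norm (S *v y))\<^sup>2 + (norm x)\<^sup>2 + (norm y)\<^sup>2"
    unfolding norm_halves[of "_ *v _"] halves_block2 x_def[symmetric] y_def[symmetric]
    by simp
  also have "\<dots> \<ge> (sqrt (1 + s\<^sup>2) * norm z)\<^sup>2"
    using ge[of x] ge[of y] norm_halves[of z]
    by (simp add: x_def y_def power_mult_distrib algebra_simps)
  finally show ?thesis
    by (rule power2_le_imp_le) simp
qed

lemma idx_less_mono: "i < j \<Longrightarrow> idx i < idx j"
  unfolding idx_def by (rule psubset_card_mono) auto

lemma idx_eq_iff [simp]: "idx i = idx j \<longleftrightarrow> i = j"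
  by (metis idx_less_mono linorder_less_linear less_irrefl)

lemma idx_less_CARD:
  fixes i :: "'n::{finite,linorder}"
  shows "idx i < CARD('n)"
  unfolding idx_def by (rule psubset_card_mono) auto

lemma bij_betw_idx: "bij_betw idx (UNIV :: 'n set) {..<CARD('n::{finite,linorder})}"
proof -
  have "inj (idx :: 'n \<Rightarrow> nat)" by (rule injI) simp
  moreover have "range (idx :: 'n \<Rightarrow> nat) = {..<CARD('n)}"
    using idx_less_CARD calculation by (intro card_subset_eq) (auto simp: card_image)
  ultimately show ?thesis by (simp add: bij_betw_def)
qed

lemma ex_idx:
  assumes "n < CARD('n::{finite,linorder})"
  shows "\<exists>i :: 'n::{finite,linorder}. idx i = n"
  using assms bij_betw_idx[where 'n = 'n] unfolding bij_betw_def by (metis imageE lessThan_iff)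

definition idist :: "'n::{finite,linorder} \<Rightarrow> 'n \<Rightarrow> nat" where
  "idist i j = nat \<bar>int (idx i) - int (idx j)\<bar>"

lemma idist_commute: "idist i j = idist j i"
  by (simp add: idist_def abs_minus_commute)

lemma idist_less:
  fixes i j :: "'n::{finite,linorder}"
  shows "idist i j < CARD('n)"
  using idx_less_CARD[of i] idx_less_CARD[of j] by (simp add: idist_def)

lemma sum_corner_row_le:
  fixes f :: "nat \<Rightarrow> real" and i :: "'n::{finite,linorder}"
  assumes f: "\<And>p. 0 \<le> f p" and q: "q \<le> CARD('n) div 2 + 1"
  shows "(\<Sum>j\<in>UNIV. if CARD('n) - idist i j \<in> {p..<q} then f (CARD('n) - idist i j) else 0)
    \<le> (\<Sum>k=p..<q. f k)"
proof -
  let ?M = "CARD('n)"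
  let ?J = "{j. ?M - idist i j \<in> {p..<q}}"
  have inj: "inj_on (\<lambda>j. ?M - idist i j) ?J"
  proof (rule inj_onI)
    fix j k assume *: "j \<in> ?J" "k \<in> ?J" "?M - idist i j = ?M - idist i k"
    have "idist i j = idist i k" "?M \<le> 2 * idist i j"
      using * q idist_less[of i j] idist_less[of i k] by auto
    then have "idx j = idx k"
      using idx_less_CARD[of i] idx_less_CARD[of j] idx_less_CARD[of k]
      unfolding idist_def by linarith
    then show "j = k" by simp
  qed
  have "(\<Sum>j\<in>UNIV. if ?M - idist i j \<in> {p..<q} then f (?M - idist i j) else 0)
      = (\<Sum>j\<in>?J. f (?M - idist i j))"
    by (simp add: sum.If_cases)
  also have "\<dots> = sum f ((\<lambda>j. ?M - idist i j) ` ?J)"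
    using inj by (simp add: sum.reindex)
  also have "\<dots> \<le> (\<Sum>k=p..<q. f k)"
    using f by (intro sum_mono2) auto
  finally show ?thesis .
qed

lemma corner_kernel:
  fixes w :: "nat \<Rightarrow> real" and x :: "real^('n::{finite,linorder})"
  assumes k: "1 \<le> k" "2 * k \<le> CARD('n)" and w: "w (CARD('n) - k) \<noteq> 0"
    and zero: "\<And>i::'n. (\<Sum>j\<in>UNIV. (if CARD('n) - k \<le> idist i j then w (idist i j) else 0) * x$j) = 0"
    and j: "idx j < k \<or> CARD('n) - k \<le> idx j"
  shows "x$j = 0"
proof -
  let ?M = "CARD('n)"
  have solve: "x$j = 0" if "idist i j = ?M - k"
    and "\<And>l. l \<noteq> j \<Longrightarrow> ?M - k \<le> idist i l \<Longrightarrow> x$l = 0" for i j :: 'n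
  proof -
    have "(\<Sum>l\<in>UNIV. (if ?M - k \<le> idist i l then w (idist i l) else 0) * x$l)
        = (\<Sum>l\<in>UNIV. if l = j then w (?M - k) * x$j else 0)"
      using that by (intro sum.cong) auto
    then show ?thesis using zero[of i] w by simp
  qed
  have upper: "x$j = 0" if "?M - k \<le> idx j" for j :: 'n
    using that
  proof (induction "?M - idx j" arbitrary: j rule: less_induct)
    case less
    obtain i :: 'n where i: "idx i = idx j - (?M - k)"
      using ex_idx[OF less_imp_diff_less[OF idx_less_CARD[of j], of "?M - k"]] by blast
    show ?case
    proof (rule solve)
      show "idist i j = ?M - k"
        using i less.prems k by (simp add: idist_def)
      fix l :: 'n assume l: "l \<noteq> j" "?M - k \<le> idist i l"
      then have "idx l \<noteq> idx j" by simp
      then have "idx j < idx l"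
        using l i less.prems k idx_less_CARD[of j] idx_less_CARD[of l] unfolding idist_def by linarith
      then show "x$l = 0"
        using less.prems idx_less_CARD[of l] by (intro less.hyps) auto
    qed
  qed
  have lower: "x$j = 0" if "idx j < k" for j :: 'n
    using that
  proof (induction "idx j" arbitrary: j rule: less_induct)
    case less
    obtain i :: 'n where i: "idx i = idx j + (?M - k)"
      using ex_idx[of "idx j + (?M - k)", where 'n = 'n] less.prems k by force
    show ?case
    proof (rule solve)
      show "idist i j = ?M - k"
        using i less.prems k by (simp add: idist_def)
      fix l :: 'n assume l: "l \<noteq> j" "?M - k \<le> idist i l"
      then have "idx l \<noteq> idx j" by simp
      then have "idx l < idx j"
        using l i less.prems k idx_less_CARD[of j] idx_less_CARD[of l] unfolding idist_def by linarith
      then show "x$l = 0"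
        using less.prems by (intro less.hyps) auto
    qed
  qed
  show ?thesis using j upper lower by blast
qed

lemma card_corner_indices:
  assumes "2 * k \<le> CARD('n::{finite,linorder})"
  shows "card {j::'n::{finite,linorder}. idx j < k \<or> CARD('n::{finite,linorder}) - k \<le> idx j} = 2 * k"
proof -
  let ?S = "{j::'n. idx j < k \<or> CARD('n) - k \<le> idx j}"
  have "idx ` ?S = {..<k} \<union> {CARD('n) - k..<CARD('n)}"
  proof
    show "{..<k} \<union> {CARD('n) - k..<CARD('n)} \<subseteq> idx ` ?S"
    proof
      fix n assume n: "n \<in> {..<k} \<union> {CARD('n) - k..<CARD('n)}"
      then obtain i :: 'n where "idx i = n"
        using ex_idx[of n, where 'n = 'n] assms by auto
      then show "n \<in> idx ` ?S" using n by auto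
    qed
  qed (auto simp: idx_less_CARD)
  moreover have "card ({..<k} \<union> {CARD('n) - k..<CARD('n)}) = 2 * k"
    using assms by (subst card_Un_disjoint) auto
  moreover have "inj_on idx ?S" by (rule inj_onI) simp
  ultimately show ?thesis using card_image[of idx ?S] by simp
qed

lemma toeplitz_T_entry: "toeplitz_T \<alpha> \<mu> $ i $ j = \<mu> * frac_coef \<alpha> (int (idist i j))"
  using frac_coef_minus[of \<alpha> "int (idx j) - int (idx i)"]
  by (simp add: toeplitz_T_def idist_def abs_if)

lemma strang_row_reflect:
  assumes "even M" "0 < r" "r < int M"
  shows "strang_row \<alpha> M (int M - r) = strang_row \<alpha> M r"
proof -
  obtain m where "M = 2 * m" using assms(1) by blast
  then show ?thesis using assms by (auto simp: strang_row_def)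
qed

lemma strang_C_entry:
  fixes i j :: "'n::{finite,linorder}"
  assumes "even CARD('n)"
  shows "strang_C \<alpha> \<mu> $ i $ j = \<mu> * strang_row \<alpha> CARD('n) (int (idist i j))"
proof (cases "idx i \<le> idx j")
  case True
  then show ?thesis
    using idx_less_CARD[of j] by (simp add: strang_C_def idist_def)
next
  case False
  have "(int (idx j) - int (idx i)) mod int CARD('n)
      = (int CARD('n) - int (idist i j)) mod int CARD('n)"
    using False by (simp add: idist_def mod_diff_left_eq[symmetric, of "int CARD('n)"])
  also have "\<dots> = int CARD('n) - int (idist i j)"
    using False idx_less_CARD[of i] by (intro mod_pos_pos_trivial) (auto simp: idist_def)
  finally show ?thesis
    using strang_row_reflect[OF assms, of "int (idist i j)" \<alpha>] False idist_less[of i j]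
    by (simp add: strang_C_def idist_def)
qed

definition strang_gap :: "real \<Rightarrow> nat \<Rightarrow> nat \<Rightarrow> real" where
  "strang_gap \<alpha> M r = frac_coef \<alpha> (int r) - strang_row \<alpha> M (int r)"

lemma strang_gap_eq_0: "even M \<Longrightarrow> 2 * r < M \<Longrightarrow> strang_gap \<alpha> M r = 0"
  by (auto simp: strang_gap_def strang_row_def elim!: evenE)

lemma strang_gap_corner:
  assumes "even M" "M \<le> 2 * r" "r < M"
  shows "strang_gap \<alpha> M r
    = frac_coef \<alpha> (int r) - (if M = 2 * r then 0 else frac_coef \<alpha> (int (M - r)))"
  using assms by (auto simp: strang_gap_def strang_row_def of_nat_diff elim!: evenE)

lemma spec_norm_le: "(\<And>x. norm (A *v x) \<le> c * norm x) \<Longrightarrow> spec_norm A \<le> c"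
  unfolding spec_norm_def by (rule onorm_le)

lemma norm_symmetric_mult_le:
  fixes W :: "real^'n^'n"
  assumes "\<And>i j. W$i$j = W$j$i" "\<And>i. (\<Sum>j\<in>UNIV. \<bar>W$i$j\<bar>) \<le> R"
  shows "norm (W *v x) \<le> R * norm x"
proof (rule norm_matrix_vector_mult_le_row_col_sums)
  show "(\<Sum>i\<in>UNIV. \<bar>W$i$j\<bar>) \<le> R" for j
    using assms(2)[of j] by (simp add: assms(1)[of _ j])
qed (rule assms(2))

lemma norm_block_diag_mult_le:
  assumes W: "\<And>x. norm (W *v x) \<le> R * norm x" and R: "0 \<le> R"
  shows "norm (block2 W 0 0 W *v z) \<le> R * norm z"
proof (rule power2_le_imp_le)
  have "(norm (W *v x))\<^sup>2 \<le> R\<^sup>2 * (norm x)\<^sup>2" for x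
    using power_mono[OF W[of x], of 2] by (simp add: power_mult_distrib)
  from add_mono[OF this[of "upper_half z"] this[of "lower_half z"]]
  show "(norm (block2 W 0 0 W *v z))\<^sup>2 \<le> (R * norm z)\<^sup>2"
    by (simp add: norm_halves[of "_ *v _"] halves_block2 norm_halves[of z] power_mult_distrib
        distrib_left)
qed (use R in simp)

lemma sum_circulant_row_le:
  fixes f :: "int \<Rightarrow> real" and i :: "'n::{finite,linorder}"
  assumes f: "\<And>r. 0 \<le> f r"
  shows "(\<Sum>j\<in>UNIV - {i}. f ((int (idx j) - int (idx i)) mod int CARD('n)))
    \<le> (\<Sum>r=1..<CARD('n). f (int r))"
proof -
  let ?M = "CARD('n)"
  define \<rho> where "\<rho> j = (int (idx j) - int (idx i)) mod int ?M" for j :: 'n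
  have \<rho>: "0 \<le> \<rho> j" "\<rho> j < int ?M" for j
    by (simp_all add: \<rho>_def)
  have eq: "j = k" if "\<rho> j = \<rho> k" for j k
  proof (rule ccontr)
    assume "j \<noteq> k"
    have "int ?M dvd int (idx j) - int (idx k)"
      using that by (simp add: \<rho>_def mod_eq_dvd_iff)
    moreover have "int (idx j) - int (idx k) \<noteq> 0" using \<open>j \<noteq> k\<close> by simp
    ultimately have "\<bar>int ?M\<bar> \<le> \<bar>int (idx j) - int (idx k)\<bar>"
      by (rule dvd_imp_le_int[rotated])
    then show False
      using idx_less_CARD[of j] idx_less_CARD[of k] by linarith
  qed
  have "\<rho> j \<noteq> 0" if "j \<noteq> i" for j
    using eq[of j i] that by (auto simp: \<rho>_def)
  then have sub: "\<rho> ` (UNIV - {i}) \<subseteq> int ` {1..<?M}"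
  proof (intro subsetI)
    fix r assume "r \<in> \<rho> ` (UNIV - {i})"
    then obtain j where j: "j \<noteq> i" "r = \<rho> j" by auto
    with \<open>\<And>j. j \<noteq> i \<Longrightarrow> \<rho> j \<noteq> 0\<close>[of j] \<rho>[of j] show "r \<in> int ` {1..<?M}"
      by (intro image_eqI[of _ _ "nat r"]) auto
  qed
  have "(\<Sum>j\<in>UNIV - {i}. f (\<rho> j)) = sum f (\<rho> ` (UNIV - {i}))"
    by (subst sum.reindex) (auto intro: inj_onI eq)
  also have "\<dots> \<le> sum f (int ` {1..<?M})"
    using f sub by (intro sum_mono2) auto
  also have "\<dots> = (\<Sum>r=1..<?M. f (int r))"
    by (subst sum.reindex) auto
  finally show ?thesis by (simp add: \<rho>_def)
qed

context
  fixes \<alpha> :: real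
  assumes \<alpha>: "1 < \<alpha>" "\<alpha> < 2"
begin

lemma strang_gap_abs_le:
  assumes "even M" "M \<le> 2 * r" "r < M"
  shows "\<bar>strang_gap \<alpha> M r\<bar> \<le> \<bar>frac_coef \<alpha> (int (M - r))\<bar>"
proof (cases "M = 2 * r")
  case False
  then have "frac_coef \<alpha> (int (M - r)) < frac_coef \<alpha> (int r)"
    using assms by (intro frac_coef_strict_mono \<alpha>) auto
  moreover have "frac_coef \<alpha> (int r) < 0"
    using assms by (intro frac_coef_neg \<alpha>) auto
  ultimately show ?thesis
    using False strang_gap_corner[OF assms, of \<alpha>] by simp
qed (use strang_gap_corner[OF assms, of \<alpha>] in simp)

lemma strang_gap_nonzero:
  assumes "even M" "M \<le> 2 * r" "r < M"
  shows "strang_gap \<alpha> M r \<noteq> 0"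
proof (cases "M = 2 * r")
  case True
  then show ?thesis
    using assms frac_coef_neg[OF \<alpha>, of r] strang_gap_corner[OF assms, of \<alpha>] by simp
next
  case False
  then have "frac_coef \<alpha> (int (M - r)) < frac_coef \<alpha> (int r)"
    using assms by (intro frac_coef_strict_mono \<alpha>) auto
  then show ?thesis
    using False strang_gap_corner[OF assms, of \<alpha>] by simp
qed

lemma sum_strang_row:
  assumes "even M" "2 \<le> M"
  shows "(\<Sum>r=1..<M. \<bar>strang_row \<alpha> M (int r)\<bar>) = 2 * (frac_tail \<alpha> 1 - frac_tail \<alpha> (real M / 2))"
proof -
  obtain m where M: "M = 2 * m" and m: "1 \<le> m"
    using assms by (auto elim!: evenE)
  have "(\<Sum>r=1..<M. \<bar>strang_row \<alpha> M (int r)\<bar>)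
      = (\<Sum>r=1..<m. \<bar>strang_row \<alpha> M (int r)\<bar>) + (\<Sum>r=m..<M. \<bar>strang_row \<alpha> M (int r)\<bar>)"
    using m M by (simp add: sum.atLeastLessThan_concat)
  also have "(\<Sum>r=1..<m. \<bar>strang_row \<alpha> M (int r)\<bar>) = (\<Sum>r=1..<m. \<bar>frac_coef \<alpha> (int r)\<bar>)"
    by (intro sum.cong) (auto simp: strang_row_def M)
  also have "(\<Sum>r=m..<M. \<bar>strang_row \<alpha> M (int r)\<bar>) = (\<Sum>r=Suc m..<M. \<bar>strang_row \<alpha> M (int r)\<bar>)"
    using m by (subst sum.atLeast_Suc_lessThan) (auto simp: strang_row_def M)
  also have "\<dots> = (\<Sum>r=1..<m. \<bar>frac_coef \<alpha> (int r)\<bar>)"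
    by (rule sum.reindex_bij_witness[of _ "\<lambda>r. M - r" "\<lambda>r. M - r"])
      (auto simp: strang_row_def M of_nat_diff)
  finally show ?thesis
    using sum_abs_frac_coef[OF \<alpha> order.refl m] by (simp add: M)
qed

lemma strang_C_coercive:
  fixes x :: "real^('n::{finite,linorder})"
  assumes M: "even CARD('n)" "2 \<le> CARD('n)" and \<mu>: "0 < \<mu>"
  shows "2 * \<mu> * frac_tail \<alpha> (real CARD('n) / 2) * (norm x)\<^sup>2 \<le> x \<bullet> (strang_C \<alpha> \<mu> *v x)"
proof -
  let ?C = "strang_C \<alpha> \<mu> :: real^('n::{finite,linorder})^('n::{finite,linorder})"
  let ?t = "frac_tail \<alpha> (real CARD('n) / 2)"
  define N :: "real^('n::{finite,linorder})^('n::{finite,linorder})" where "N = (\<chi> i j. if j = i then 0 else ?C$i$j)"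
  have "strang_row \<alpha> CARD('n) 0 = frac_coef \<alpha> 0"
    using M by (auto simp: strang_row_def)
  then have C: "?C = (\<mu> * frac_coef \<alpha> 0) *\<^sub>R mat 1 + N"
    by (auto simp: N_def vec_eq_iff mat_def strang_C_def)
  have "norm (N *v x) \<le> (\<mu> * (2 * (frac_tail \<alpha> 1 - ?t))) * norm x"
  proof (rule norm_symmetric_mult_le)
    show "N$i$j = N$j$i" for i j
      using M by (auto simp: N_def strang_C_entry idist_commute)
    fix i
    have "(\<Sum>j\<in>UNIV. \<bar>N$i$j\<bar>) = (\<Sum>j\<in>UNIV - {i}. \<bar>?C$i$j\<bar>)"
      by (subst sum.remove[of _ i]) (auto simp: N_def intro!: sum.cong)
    also have "\<dots> = \<mu> * (\<Sum>j\<in>UNIV - {i}. \<bar>strang_row \<alpha> CARD('n)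
        ((int (idx j) - int (idx i)) mod int CARD('n))\<bar>)"
      using \<mu> by (simp add: strang_C_def abs_mult sum_distrib_left)
    also have "\<dots> \<le> \<mu> * (2 * (frac_tail \<alpha> 1 - ?t))"
      using sum_circulant_row_le[of "\<lambda>r. \<bar>strang_row \<alpha> CARD('n) r\<bar>" i] sum_strang_row[OF M] \<mu>
      by (intro mult_left_mono) auto
    finally show "(\<Sum>j\<in>UNIV. \<bar>N$i$j\<bar>) \<le> \<mu> * (2 * (frac_tail \<alpha> 1 - ?t))" .
  qed
  then have "norm x * norm (N *v x) \<le> norm x * ((\<mu> * (2 * (frac_tail \<alpha> 1 - ?t))) * norm x)"
    by (rule mult_left_mono) simp
  moreover have "\<bar>x \<bullet> (N *v x)\<bar> \<le> norm x * norm (N *v x)"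
    by (rule Cauchy_Schwarz_ineq2)
  moreover have "x \<bullet> (?C *v x) = \<mu> * frac_coef \<alpha> 0 * (norm x)\<^sup>2 + x \<bullet> (N *v x)"
    unfolding C by (simp add: matrix_vector_mult_add_rdistrib inner_add_right power2_norm_eq_inner
        flip: scaleR_matrix_vector_assoc)
  ultimately show ?thesis
    by (simp add: frac_coef_0[OF \<alpha>] power2_eq_square algebra_simps)
qed

end

lemma strang_preconditioner_splitting:
  fixes P :: "real^('n::{finite,linorder}+'n)^('n+'n)" and \<alpha> \<mu> \<omega> :: real and k :: nat
  assumes \<alpha>: "1 < \<alpha>" "\<alpha> < 2" and M: "even CARD('n)" and k: "1 \<le> k" "2 * k \<le> CARD('n)"
    and \<mu>: "0 < \<mu>" and \<omega>: "0 < \<omega>" and P: "invertible P"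
  defines "I \<equiv> mat 1 :: real^('n::{finite,linorder})^('n::{finite,linorder})"
  defines "Q \<equiv> \<omega> *\<^sub>R mat 1 + block2 (strang_C \<alpha> \<mu>) (- I) I (strang_C \<alpha> \<mu>)"
    and "R \<equiv> \<omega> *\<^sub>R mat 1 + block2 (toeplitz_T \<alpha> \<mu>) (- I) I (toeplitz_T \<alpha> \<mu>)"
    and "d \<equiv> sqrt (1 + (\<omega> + 2 * \<mu> * frac_tail \<alpha> (real CARD('n) / 2))\<^sup>2)"
  shows "\<exists>E F. rank E = 4 * k
    \<and> spec_norm E \<le> \<mu> * (frac_tail \<alpha> 1 - frac_tail \<alpha> (real k + 1)) / d
    \<and> spec_norm F \<le> \<mu> * frac_tail \<alpha> (real k + 1) / d
    \<and> matrix_inv (P ** Q) ** (P ** R) = mat 1 + E + F"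
proof -
  let ?M = "CARD('n)"
  define C :: "real^('n::{finite,linorder})^('n::{finite,linorder})" where "C = strang_C \<alpha> \<mu>"
  define T :: "real^('n::{finite,linorder})^('n::{finite,linorder})" where "T = toeplitz_T \<alpha> \<mu>"
  define S where "S = \<omega> *\<^sub>R mat 1 + C"
  define s where "s = \<omega> + 2 * \<mu> * frac_tail \<alpha> (real ?M / 2)"
  have M2: "2 \<le> ?M" using k by simp
  have s: "0 \<le> s"
    using \<omega> \<mu> frac_tail_pos[OF \<alpha>, of "real ?M / 2"] M2 by (simp add: s_def)
  have d: "0 < d"
    by (simp add: d_def add_pos_nonneg)
  have Q: "Q = block2 S (- mat 1) (mat 1) S"
    by (simp add: Q_def S_def C_def I_def scaleR_mat_1_block2 add_block2)
  have symS: "transpose S = S"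
    using M by (auto simp: S_def C_def transpose_def vec_eq_iff mat_def strang_C_entry idist_commute)
  have coercive: "s * (norm x)\<^sup>2 \<le> x \<bullet> (S *v x)" for x
  proof -
    have "x \<bullet> (S *v x) = \<omega> * (norm x)\<^sup>2 + x \<bullet> (C *v x)"
      by (simp add: S_def matrix_vector_mult_add_rdistrib inner_add_right power2_norm_eq_inner
          flip: scaleR_matrix_vector_assoc)
    then show ?thesis
      using strang_C_coercive[OF \<alpha> M M2 \<mu>, of x] by (simp add: s_def C_def algebra_simps)
  qed
  have Qge: "d * norm z \<le> norm (Q *v z)" for z
    using norm_skew_block2_ge[OF symS coercive s, of z] by (simp add: Q d_def s_def)
  have Qker: "z = 0" if "Q *v z = 0" for z
    using Qge[of z] d that by (simp add: mult_le_0_iff)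
  then obtain N where N: "N ** Q = mat 1"
    using matrix_left_invertible_ker[of Q] by blast
  then have N': "Q ** N = mat 1"
    by (simp add: matrix_left_right_inverse)
  have Nker: "z = 0" if "N *v z = 0" for z
    using that N' by (metis matrix_vector_mul_assoc matrix_vector_mul_lid matrix_vector_mult_0_right)
  have Nle: "norm (N *v z) \<le> norm z / d" for z
    using Qge[of "N *v z"] d N' by (simp add: matrix_vector_mul_assoc field_simps)

  define WE :: "real^('n::{finite,linorder})^('n::{finite,linorder})"
    where "WE = (\<chi> i j. if ?M - k \<le> idist i j then \<mu> * strang_gap \<alpha> ?M (idist i j) else 0)"
  define WF :: "real^('n::{finite,linorder})^('n::{finite,linorder})"
    where "WF = (\<chi> i j. if ?M - k \<le> idist i j then 0 else \<mu> * strang_gap \<alpha> ?M (idist i j))"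
  have TC: "T = C + WE + WF"
    using M by (auto simp: T_def C_def WE_def WF_def vec_eq_iff toeplitz_T_entry strang_C_entry
        strang_gap_def algebra_simps)
  have RQ: "R = Q + block2 WE 0 0 WE + block2 WF 0 0 WF"
    unfolding R_def Q_def T_def[symmetric] C_def[symmetric] TC
    by (simp add: add_block2 add.assoc)

  let ?f = "\<lambda>p. \<mu> * \<bar>frac_coef \<alpha> (int p)\<bar>"
  have f: "0 \<le> ?f p" for p using \<mu> by simp
  have gap: "\<bar>\<mu> * strang_gap \<alpha> ?M (idist i j)\<bar> \<le> ?f (?M - idist i j)"
    if "?M \<le> 2 * idist i j" for i j :: 'n
    using strang_gap_abs_le[OF \<alpha> M that idist_less] \<mu> by (simp add: abs_mult)
  have WE: "norm (WE *v x) \<le> (\<mu> * (frac_tail \<alpha> 1 - frac_tail \<alpha> (real k + 1))) * norm x" for x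
  proof (rule norm_symmetric_mult_le)
    show "WE$i$j = WE$j$i" for i j by (simp add: WE_def idist_commute)
    fix i
    have "(\<Sum>j\<in>UNIV. \<bar>WE$i$j\<bar>)
        \<le> (\<Sum>j\<in>UNIV. if ?M - idist i j \<in> {1..<k + 1} then ?f (?M - idist i j) else 0)"
    proof (intro sum_mono)
      fix j
      show "\<bar>WE$i$j\<bar> \<le> (if ?M - idist i j \<in> {1..<k + 1} then ?f (?M - idist i j) else 0)"
        using gap[of i j] idist_less[of i j] k f[of "?M - idist i j"] unfolding WE_def by auto
    qed
    also have "\<dots> \<le> (\<Sum>p=1..<k + 1. ?f p)"
      using f k by (intro sum_corner_row_le) auto
    also have "\<dots> = \<mu> * (frac_tail \<alpha> 1 - frac_tail \<alpha> (real k + 1))"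
      using sum_abs_frac_coef[OF \<alpha>, of 1 "k + 1"] by (simp add: add.commute flip: sum_distrib_left)
    finally show "(\<Sum>j\<in>UNIV. \<bar>WE$i$j\<bar>) \<le> \<mu> * (frac_tail \<alpha> 1 - frac_tail \<alpha> (real k + 1))" .
  qed
  have WF: "norm (WF *v x) \<le> (\<mu> * frac_tail \<alpha> (real k + 1)) * norm x" for x
  proof (rule norm_symmetric_mult_le)
    show "WF$i$j = WF$j$i" for i j by (simp add: WF_def idist_commute)
    fix i
    have "(\<Sum>j\<in>UNIV. \<bar>WF$i$j\<bar>)
        \<le> (\<Sum>j\<in>UNIV. if ?M - idist i j \<in> {k + 1..<?M div 2 + 1} then ?f (?M - idist i j) else 0)"
    proof (intro sum_mono)
      fix j
      show "\<bar>WF$i$j\<bar> \<le> (if ?M - idist i j \<in> {k + 1..<?M div 2 + 1} then ?f (?M - idist i j) else 0)"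
      proof (cases "?M \<le> 2 * idist i j")
        case True
        then show ?thesis
          using gap[of i j] idist_less[of i j] k f[of "?M - idist i j"] unfolding WF_def by auto
      next
        case False
        then show ?thesis
          using strang_gap_eq_0[OF M, of "idist i j" \<alpha>] f[of "?M - idist i j"] unfolding WF_def by auto
      qed
    qed
    also have "\<dots> \<le> (\<Sum>p=k + 1..<?M div 2 + 1. ?f p)"
      using f by (intro sum_corner_row_le) auto
    also have "\<dots> = \<mu> * (frac_tail \<alpha> (real (k + 1)) - frac_tail \<alpha> (real (?M div 2 + 1)))"
      using sum_abs_frac_coef[OF \<alpha>, of "k + 1" "?M div 2 + 1"] k by (simp flip: sum_distrib_left)
    also have "\<dots> \<le> \<mu> * frac_tail \<alpha> (real k + 1)"
      using \<mu> frac_tail_pos[OF \<alpha>, of "real (?M div 2 + 1)"]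
      by (intro mult_left_mono) (auto simp: add.commute)
    finally show "(\<Sum>j\<in>UNIV. \<bar>WF$i$j\<bar>) \<le> \<mu> * frac_tail \<alpha> (real k + 1)" .
  qed
  have prod_le: "spec_norm (N ** block2 W 0 0 W) \<le> r / d"
    if "\<And>x. norm (W *v x) \<le> r * norm x" "0 \<le> r" for W r
  proof (rule spec_norm_le)
    fix x
    have "norm ((N ** block2 W 0 0 W) *v x) \<le> norm (block2 W 0 0 W *v x) / d"
      using Nle[of "block2 W 0 0 W *v x"] by (simp only: matrix_vector_mul_assoc)
    also have "\<dots> \<le> (r * norm x) / d"
      using d by (intro divide_right_mono norm_block_diag_mult_le that) auto
    finally show "norm ((N ** block2 W 0 0 W) *v x) \<le> r / d * norm x" by simp
  qed
  have 1: "spec_norm (N ** block2 WE 0 0 WE) \<le> \<mu> * (frac_tail \<alpha> 1 - frac_tail \<alpha> (real k + 1)) / d"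
    using \<mu> frac_tail_Suc_le_1[OF \<alpha>, of k] by (intro prod_le WE) simp
  have 2: "spec_norm (N ** block2 WF 0 0 WF) \<le> \<mu> * frac_tail \<alpha> (real k + 1) / d"
    using \<mu> frac_tail_pos[OF \<alpha>, of "real k + 1"] by (intro prod_le WF) simp

  let ?S = "{j::'n. idx j < k \<or> ?M - k \<le> idx j}"
  have outside: "idist i j < ?M - k" if "i \<notin> ?S" for i j :: 'n
    using that idx_less_CARD[of i] idx_less_CARD[of j] k by (auto simp: idist_def)
  have WEker: "x$j = 0" if "WE *v x = 0" "j \<in> ?S" for x j
  proof (rule corner_kernel[OF k, where w = "\<lambda>r. \<mu> * strang_gap \<alpha> ?M r"])
    show "\<mu> * strang_gap \<alpha> ?M (?M - k) \<noteq> 0"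
      using strang_gap_nonzero[OF \<alpha> M, of "?M - k"] k \<mu> by auto
    show "(\<Sum>l\<in>UNIV. (if ?M - k \<le> idist i l then \<mu> * strang_gap \<alpha> ?M (idist i l) else 0) * x$l) = 0" for i
      using that(1) by (simp add: WE_def vec_eq_iff matrix_vector_mult_def)
    show "idx j < k \<or> ?M - k \<le> idx j" using that(2) by simp
  qed
  have 3: "rank (N ** block2 WE 0 0 WE) = card (?S <+> ?S)"
  proof (rule rank_mult_eq_card_support[OF Nker])
    have WE0: "WE$i$j = 0" if "i \<notin> ?S" for i j
      using outside[OF that, of j] by (simp add: WE_def)
    show "block2 WE 0 0 WE $ i $ j = 0" if i: "i \<notin> ?S <+> ?S" for i j
    proof (cases i)
      case (Inl a)
      then have "a \<notin> ?S" using i by blast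
      then show ?thesis by (simp add: Inl block2_def WE0 split: sum.split)
    next
      case (Inr a)
      then have "a \<notin> ?S" using i by blast
      then show ?thesis by (simp add: Inr block2_def WE0 split: sum.split)
    qed
  next
    fix x assume x: "\<And>j. j \<notin> ?S <+> ?S \<Longrightarrow> x$j = 0" and "block2 WE 0 0 WE *v x = 0"
    then have "upper_half (block2 WE 0 0 WE *v x) = 0" "lower_half (block2 WE 0 0 WE *v x) = 0"
      by (simp_all add: upper_half_def lower_half_def vec_eq_iff)
    then have W0: "WE *v upper_half x = 0" "WE *v lower_half x = 0"
      by (simp_all add: halves_block2)
    have "upper_half x $ j = 0" for j
      using WEker[OF W0(1), of j] x[of "Inl j"] by (cases "j \<in> ?S") (auto simp: upper_half_def)
    moreover have "lower_half x $ j = 0" for j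
      using WEker[OF W0(2), of j] x[of "Inr j"] by (cases "j \<in> ?S") (auto simp: lower_half_def)
    ultimately show "x = 0"
      by (intro halves_zero) (simp_all add: vec_eq_iff)
  qed
  also have "\<dots> = 4 * k"
    using card_corner_indices[OF k(2)] by (simp add: card_Plus)
  finally have 3: "rank (N ** block2 WE 0 0 WE) = 4 * k" .

  have "invertible Q" using N N' by (auto simp: invertible_def)
  with P have "invertible (P ** Q)" by (rule invertible_mult)
  then have "matrix_inv (P ** Q) ** (P ** Q) = mat 1"
    unfolding invertible_def matrix_inv_def by (rule someI_ex[THEN conjunct2])
  moreover have "P ** R = (P ** Q) ** (N ** R)"
    by (metis N' matrix_mul_assoc matrix_mul_lid)
  ultimately have "matrix_inv (P ** Q) ** (P ** R) = N ** R"
    by (metis matrix_mul_assoc matrix_mul_lid)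
  also have "\<dots> = mat 1 + N ** block2 WE 0 0 WE + N ** block2 WF 0 0 WF"
    by (simp add: RQ matrix_add_ldistrib N)
  finally show ?thesis
    using 1 2 3 by blast
qed

lemma invertible_shifted_diag_block2:
  fixes D :: "real^'n^'n"
  assumes "\<forall>i j. i \<noteq> j \<longrightarrow> D$i$j = 0" "\<forall>i. D$i$i \<le> 0" "0 < \<omega>" "c \<noteq> 0"
  shows "invertible (c *\<^sub>R (\<omega> *\<^sub>R mat 1 + block2 (- D) 0 0 (- D)))"
proof -
  define G where "G = \<omega> *\<^sub>R mat 1 + - D"
  have G: "x = 0" if "G *v x = 0" for x
  proof -
    have "(G *v x)$i = (\<omega> - D$i$i) * x$i" for i
    proof -
      have "(G *v x)$i = (\<Sum>j\<in>UNIV. G$i$j * x$j)"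
        by (simp add: matrix_vector_mult_def)
      also have "\<dots> = (\<Sum>j\<in>UNIV. if j = i then (\<omega> - D$i$i) * x$i else 0)"
        using assms(1) by (intro sum.cong) (auto simp: G_def mat_def)
      finally show ?thesis by simp
    qed
    moreover have "\<omega> - D$i$i \<noteq> 0" for i
      using spec[OF assms(2), of i] assms(3) by linarith
    ultimately show ?thesis
      using that by (simp add: vec_eq_iff)
  qed
  have "z = 0" if "(c *\<^sub>R block2 G 0 0 G) *v z = 0" for z
  proof -
    have "block2 G 0 0 G *v z = 0"
      using that assms(4) scaleR_matrix_vector_assoc[of c "block2 G 0 0 G" z] by simp
    then have "upper_half (block2 G 0 0 G *v z) = 0" "lower_half (block2 G 0 0 G *v z) = 0"
      by (simp_all add: upper_half_def lower_half_def vec_eq_iff)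
    then show ?thesis
      by (intro halves_zero G[of "upper_half z"] G[of "lower_half z"]) (simp_all add: halves_block2)
  qed
  then have "invertible (c *\<^sub>R block2 G 0 0 G)"
    unfolding invertible_left_inverse matrix_left_invertible_ker by blast
  moreover have "\<omega> *\<^sub>R mat 1 + block2 (- D) 0 0 (- D) = block2 G 0 0 G"
    by (simp add: G_def scaleR_mat_1_block2 add_block2)
  ultimately show ?thesis
    by (simp only:)
qed

theorem theorem4:
  fixes \<alpha> \<gamma> \<tau> a b \<omega> \<epsilon> h \<mu> \<theta> \<theta>\<^sub>0 :: real
    and M k\<^sub>0 :: nat
    and D :: "real^('n::{finite,linorder})^('n::{finite,linorder})"
  assumes "1 < \<alpha>" "\<alpha> < 2" "\<gamma> > 0" "\<tau> > 0" "a < b"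
    and "M = CARD('n)" "M \<ge> 8" "even M"
    and "h = (b - a) / (real M + 1)"
    and "\<mu> = \<gamma> * \<tau> / h powr \<alpha>"
    and "\<forall>i j. i \<noteq> j \<longrightarrow> D$i$j = 0" "\<forall>i. D$i$i \<le> 0"
    and "\<omega> > 0"
    and "\<theta> = (1 - (1 + \<alpha>) / (5 + \<alpha>/2)) powr (5 + \<alpha>/2) * exp (1 + \<alpha>) * Gamma (\<alpha> + 1)
               * sin (pi * \<alpha> / 2) / (pi * \<alpha>)"
    and "\<theta>\<^sub>0 = sqrt 2 * exp (13/12) * Gamma (1 + \<alpha>) * sin (pi * \<alpha> / 2) / (pi * \<alpha>)"
    and "2 powr \<alpha> * \<mu> * \<theta>\<^sub>0 / (real M - 2) powr \<alpha> < \<epsilon>" "\<epsilon> \<le> \<mu> * \<theta>\<^sub>0"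
    and "k\<^sub>0 = nat \<lceil>(\<mu> * \<theta>\<^sub>0 / \<epsilon>) powr (1 / \<alpha>)\<rceil> + 1"
  shows "\<exists>E F :: real^('n::{finite,linorder}+'n::{finite,linorder})^('n::{finite,linorder}+'n::{finite,linorder}).
      (let I = (mat 1 :: real^'n::{finite,linorder}^'n::{finite,linorder});
           \<BB> = block2 (- D) 0 0 (- D);
           \<HH> = block2 (toeplitz_T \<alpha> \<mu>) (- I) I (toeplitz_T \<alpha> \<mu>);
           \<CC> = block2 (strang_C \<alpha> \<mu>) (- I) I (strang_C \<alpha> \<mu>);
           I2 = (mat 1 :: real^('n::{finite,linorder}+'n::{finite,linorder})^('n::{finite,linorder}+'n::{finite,linorder}));
           F\<omega> = (1 / (2 * \<omega>)) *\<^sub>R ((\<omega> *\<^sub>R I2 + \<BB>) ** (\<omega> *\<^sub>R I2 + \<HH>));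
           Ft\<omega> = (1 / (2 * \<omega>)) *\<^sub>R ((\<omega> *\<^sub>R I2 + \<BB>) ** (\<omega> *\<^sub>R I2 + \<CC>));
           den = sqrt (1 + (\<omega> + 2 powr (\<alpha> + 1) * \<gamma> * \<tau> * \<theta> / (b - a) powr \<alpha>)\<^sup>2)
       in rank E = 4 * k\<^sub>0
          \<and> spec_norm E \<le> sqrt (real M) * \<mu> / den * (frac_coef \<alpha> 0 / 2 - \<theta> / (real M - 1/2) powr \<alpha>)
          \<and> spec_norm F \<le> sqrt (real M) * \<epsilon> / den
          \<and> matrix_inv Ft\<omega> ** F\<omega> = I2 + E + F)"
proof -
  let ?Q = "\<omega> *\<^sub>R mat 1 + block2 (strang_C \<alpha> \<mu> :: real^('n::{finite,linorder})^('n::{finite,linorder})) (- mat 1) (mat 1) (strang_C \<alpha> \<mu>)"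
  let ?R = "\<omega> *\<^sub>R mat 1 + block2 (toeplitz_T \<alpha> \<mu> :: real^('n::{finite,linorder})^('n::{finite,linorder})) (- mat 1) (mat 1) (toeplitz_T \<alpha> \<mu>)"
  let ?P = "(1 / (2 * \<omega>)) *\<^sub>R (\<omega> *\<^sub>R mat 1 + block2 (- D) 0 0 (- D))"
  define den where "den = sqrt (1 + (\<omega> + 2 powr (\<alpha> + 1) * \<gamma> * \<tau> * \<theta> / (b - a) powr \<alpha>)\<^sup>2)"
  define d where "d = sqrt (1 + (\<omega> + 2 * \<mu> * frac_tail \<alpha> (real M / 2))\<^sup>2)"
  note \<alpha> = assms(1,2)
  define A where "A = tail_const \<alpha>"
  have A: "0 < A" using tail_const_pos[OF \<alpha>] by (simp add: A_def)
  have \<mu>: "\<mu> = \<gamma> * \<tau> * (real M + 1) powr \<alpha> / (b - a) powr \<alpha>"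
    using assms(5) by (simp add: assms(9,10) powr_divide)
  have \<mu>_pos: "0 < \<mu>"
    unfolding \<mu> using assms(3-5) by simp

  have \<theta>: "0 \<le> \<theta>" "\<theta> \<le> A"
  proof -
    have eq: "\<theta> = ((1 - (1 + \<alpha>) / (5 + \<alpha>/2)) powr (5 + \<alpha>/2) * exp (1 + \<alpha>)) * A"
      by (simp add: assms(14) A_def tail_const_def)
    show "0 \<le> \<theta>" unfolding eq using A by simp
    show "\<theta> \<le> A"
      unfolding eq using powr_one_minus_div_le[of "5 + \<alpha>/2" "1 + \<alpha>"] A \<alpha>
      by (intro mult_left_le_one_le) auto
  qed
  have \<theta>\<^sub>0: "A \<le> \<theta>\<^sub>0"
  proof -
    have "1 * 1 \<le> sqrt 2 * exp (13/12 :: real)"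
      by (intro mult_mono) auto
    from mult_right_mono[OF this, of A] A show ?thesis
      by (simp add: assms(15) A_def tail_const_def add.commute)
  qed
  have \<mu>\<theta>\<^sub>0: "0 < \<mu> * \<theta>\<^sub>0" using \<mu>_pos \<theta>\<^sub>0 A by simp
  have "0 < 2 powr \<alpha> * \<mu> * \<theta>\<^sub>0 / (real M - 2) powr \<alpha>"
    using \<mu>_pos \<theta>\<^sub>0 A assms(7) by (intro divide_pos_pos mult_pos_pos) auto
  then have \<epsilon>: "0 < \<epsilon>" using assms(16) by linarith

  define y where "y = (\<mu> * \<theta>\<^sub>0 / \<epsilon>) powr (1 / \<alpha>)"
  have y\<alpha>: "y powr \<alpha> = \<mu> * \<theta>\<^sub>0 / \<epsilon>"
    using \<alpha> \<mu>\<theta>\<^sub>0 \<epsilon> by (simp add: y_def powr_powr)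
  have y1: "1 \<le> y"
    unfolding y_def using \<epsilon> assms(17) \<alpha> by (intro ge_one_powr_ge_zero) auto
  have "y powr \<alpha> < ((real M - 2) / 2) powr \<alpha>"
    using assms(16) \<epsilon> assms(7) by (simp add: y\<alpha> powr_divide field_simps)
  then have yM: "y < (real M - 2) / 2"
    using powr_mono2[of \<alpha> "(real M - 2) / 2" y] assms(7) \<alpha> by fastforce
  obtain m where m: "M = 2 * m" using assms(8) by blast
  have "\<lceil>y\<rceil> \<le> int m - 1"
    using yM by (intro ceiling_le) (simp add: m)
  moreover have "1 \<le> \<lceil>y\<rceil>" using y1 by (simp add: le_ceiling_iff)
  ultimately have "nat \<lceil>y\<rceil> + 1 \<le> m" by linarith
  then have k\<^sub>0: "1 \<le> k\<^sub>0" "2 * k\<^sub>0 \<le> M" "y \<le> real k\<^sub>0"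
    using m real_nat_ceiling_ge[of y] by (auto simp: assms(18) y_def[symmetric])

  have d_ge: "den \<le> d"
  proof -
    have "2 powr (\<alpha> + 1) * \<gamma> * \<tau> * \<theta> / (b - a) powr \<alpha>
        \<le> 2 powr (\<alpha> + 1) * \<gamma> * \<tau> * A / (b - a) powr \<alpha>"
      using \<theta> assms(3,4) by (intro divide_right_mono mult_left_mono) auto
    also have "\<dots> = 2 * \<mu> * (A / ((real M + 1) / 2) powr \<alpha>)"
      by (simp add: \<mu> powr_divide powr_add)
    also have "A / ((real M + 1) / 2) powr \<alpha> \<le> frac_tail \<alpha> (real M / 2)"
      using frac_tail_lower[OF \<alpha>, of "real M / 2"] assms(7) by (simp add: A_def add_divide_distrib)
    finally have "2 powr (\<alpha> + 1) * \<gamma> * \<tau> * \<theta> / (b - a) powr \<alpha> \<le> 2 * \<mu> * frac_tail \<alpha> (real M / 2)"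
      using \<mu>_pos by simp
    then show ?thesis
      unfolding den_def d_def using assms(3,4,13) \<theta>
      by (intro real_sqrt_le_mono add_left_mono power_mono) auto
  qed
  have den: "0 < den" by (simp add: den_def add_pos_nonneg)
  have sqrtM: "1 \<le> sqrt (real M)" using assms(7) by simp
  have scale: "x / d \<le> sqrt (real M) * y / den" if "x \<le> y" "0 \<le> x" for x y
  proof -
    have "x / d \<le> x / den" using that d_ge den by (intro divide_left_mono) auto
    also have "\<dots> \<le> sqrt (real M) * y / den"
      using that den mult_mono[OF sqrtM that(1)] by (intro divide_right_mono) auto
    finally show ?thesis .
  qed

  have tailE: "\<theta> / (real M - 1/2) powr \<alpha> \<le> frac_tail \<alpha> (real k\<^sub>0 + 1)"
  proof -
    have "\<theta> / (real M - 1/2) powr \<alpha> \<le> A / (real M - 1/2) powr \<alpha>"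
      using \<theta> by (intro divide_right_mono) auto
    also have "\<dots> \<le> A / (real k\<^sub>0 + 1 + 1/2) powr \<alpha>"
      using A k\<^sub>0 assms(7) \<alpha> by (intro divide_left_mono powr_mono2 mult_pos_pos) auto
    also have "\<dots> \<le> frac_tail \<alpha> (real k\<^sub>0 + 1)"
      using frac_tail_lower[OF \<alpha>, of "real k\<^sub>0 + 1"] by (simp add: A_def)
    finally show ?thesis .
  qed
  have tailF: "\<mu> * frac_tail \<alpha> (real k\<^sub>0 + 1) \<le> \<epsilon>"
  proof -
    have "\<mu> * \<theta>\<^sub>0 / \<epsilon> \<le> real k\<^sub>0 powr \<alpha>"
      unfolding y\<alpha>[symmetric] using y1 k\<^sub>0 \<alpha> by (intro powr_mono2) auto
    then have "\<mu> * \<theta>\<^sub>0 \<le> \<epsilon> * real k\<^sub>0 powr \<alpha>"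
      using \<epsilon> by (simp add: field_simps)
    moreover have "\<mu> * A \<le> \<mu> * \<theta>\<^sub>0" using \<mu>_pos \<theta>\<^sub>0 by simp
    ultimately have "\<mu> * (A / real k\<^sub>0 powr \<alpha>) \<le> \<epsilon>"
      using k\<^sub>0 by (simp add: field_simps)
    moreover have "\<mu> * frac_tail \<alpha> (real k\<^sub>0 + 1) \<le> \<mu> * (A / real k\<^sub>0 powr \<alpha>)"
      using frac_tail_upper[OF \<alpha>, of "real k\<^sub>0 + 1"] k\<^sub>0 \<mu>_pos
      by (intro mult_left_mono) (auto simp: A_def)
    ultimately show ?thesis by linarith
  qed

  have "invertible ?P"
    using invertible_shifted_diag_block2[OF assms(11-13), of "1 / (2 * \<omega>)"] assms(13) by simp
  from strang_preconditioner_splitting[OF \<alpha> _ k\<^sub>0(1) _ \<mu>_pos assms(13) this]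
  obtain E F where rank: "rank E = 4 * k\<^sub>0"
    and E: "spec_norm E \<le> \<mu> * (frac_tail \<alpha> 1 - frac_tail \<alpha> (real k\<^sub>0 + 1)) / d"
    and F: "spec_norm F \<le> \<mu> * frac_tail \<alpha> (real k\<^sub>0 + 1) / d"
    and split: "matrix_inv (?P ** ?Q) ** (?P ** ?R) = mat 1 + E + F"
    using assms(6,8) k\<^sub>0(2) unfolding d_def by blast
  note E
  also have "\<mu> * (frac_tail \<alpha> 1 - frac_tail \<alpha> (real k\<^sub>0 + 1)) / d
      \<le> sqrt (real M) * (\<mu> * (frac_coef \<alpha> 0 / 2 - \<theta> / (real M - 1/2) powr \<alpha>)) / den"
    using tailE frac_tail_Suc_le_1[OF \<alpha>, of k\<^sub>0] \<mu>_pos by (intro scale mult_left_mono mult_nonneg_nonneg) (auto simp: frac_coef_0[OF \<alpha>])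
  finally have E': "spec_norm E \<le> sqrt (real M) * \<mu> / den * (frac_coef \<alpha> 0 / 2 - \<theta> / (real M - 1/2) powr \<alpha>)"
    by (simp add: mult.assoc)
  have F': "spec_norm F \<le> sqrt (real M) * \<epsilon> / den"
    using F scale[OF tailF] \<mu>_pos frac_tail_pos[OF \<alpha>, of "real k\<^sub>0 + 1"] by simp
  show ?thesis
    unfolding Let_def scalar_matrix_assoc den_def[symmetric]
    using rank E' F' split by blast
qed

end
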